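(* For any $Z=(z_i)_{i=1}^\ell\subset\mathcal{X}$ and any $s\le\ell$, $$\int_{\mathcal{X}}\left(k_\mu^Z(x,x)-k_{s,\mu}^Z(x,x)\right)d\mu(x)\le\sum_{i=s+1}^\ell\sigma_i.$$
   Context: $\mathcal{X}$ is a Hausdorff space, $\mu$ a (Borel) probability measure on $\mathcal{X}$, and $k:\mathcal{X}\times\mathcal{X}\to\mathbb{R}$ a positive definite kernel (all Gram matrices are positive semi-definite) with $\int_{\mathcal{X}}k(x,x)\,d\mu(x)<\infty$ and reproducing kernel Hilbert space $\mathcal{H}_k$. The integral operator is $\mathcal{K}:L^2(\mu)\to L^2(\mu)$, $(\mathcal{K}f)(x)=\int_{\mathcal{X}}k(x,y)f(y)\,d\mu(y)$, with eigenpairs $(\sigma_i,e_i)_{i=1}^\infty$, $\sigma_1\ge\sigma_2\ge\cdots\ge0$, $(e_i)$ orthonormal in $L^2(\mu)$. Standing assumption: the Mercer decomposition $k(x,y)=\sum_{i=1}^\infty\sigma_i e_i(x)e_i(y)$ holds and $(\sqrt{\sigma_i}e_i)_{i}$ (over indices with $\sigma_i>0$) is an orthonormal basis of $\mathcal{H}_k$. For $Z=(z_i)_{i=1}^\ell$ write $k(Z,Z)=(k(z_i,z_j))_{i,j}$, $k(Z,x)=(k(z_i,x))_i\in\mathbb{R}^\ell$; $A^+$ is the Moore–Penrose pseudo-inverse of $A$. Let $h_\mu(x,y)=\int_{\mathcal{X}}k(x,t)k(t,y)\,d\mu(t)$ and $h_\mu(Z,Z)=(h_\mu(z_i,z_j))_{i,j}$.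 Take any $H\in\mathbb{R}^{\ell\times\ell}$ with $H^\top H=h_\mu(Z,Z)$, and decompose $Hk(Z,Z)^+H^\top=V\mathrm{diag}(\kappa_1,\dots,\kappa_\ell)V^\top$ with $V=[v_1,\dots,v_\ell]$ orthogonal, $\kappa_1\ge\cdots\ge\kappa_\ell\ge0$. Put $f_i(x)=(H^+v_i)^\top k(Z,x)$ and $$k_\mu^Z(x,y)=\sum_{i=1}^\ell\kappa_if_i(x)f_i(y),\qquad k_{s,\mu}^Z(x,y)=\sum_{i=1}^s\kappa_if_i(x)f_i(y)\quad(s\le\ell).$$ *)

theory Defs
  imports "HOL-Probability.Probability" "Jordan_Normal_Form.Matrix"
begin

text \<open>All indices are 0-based: \<open>\<sigma> i\<close>, \<open>e i\<close>, \<open>\<kappa> i\<close>, \<open>Z i\<close> and column \<open>i\<close> of \<open>V\<close> are the objects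
  usually numbered \<open>i + 1\<close>. A point sequence of length \<open>l\<close> is a function \<open>Z\<close> on \<open>nat\<close> of which
  only the values at \<open>i < l\<close> are used.\<close>

section \<open>Matrices\<close>

definition positive_semidefinite :: "real mat \<Rightarrow> bool" where
  "positive_semidefinite A \<longleftrightarrow>
     square_mat A \<and> transpose_mat A = A \<and>
     (\<forall>v \<in> carrier_vec (dim_row A). 0 \<le> scalar_prod v (A *\<^sub>v v))"

text \<open>The four Penrose equations; over the reals the adjoint is the transpose.\<close>

definition is_moore_penrose :: "real mat \<Rightarrow> real mat \<Rightarrow> bool" where
  "is_moore_penrose A B \<longleftrightarrow>
     B \<in> carrier_mat (dim_col A) (dim_row A) \<and>
     A * B * A = A \<and> B * A * B = B \<and>
     transpose_mat (A * B) = A * B \<and> transpose_mat (B * A) = B * A"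

definition pinv :: "real mat \<Rightarrow> real mat" where
  "pinv A = (THE B. is_moore_penrose A B)"

definition orthogonal_matrix_of_size :: "nat \<Rightarrow> real mat \<Rightarrow> bool" where
  "orthogonal_matrix_of_size l V \<longleftrightarrow>
     V \<in> carrier_mat l l \<and> transpose_mat V * V = 1\<^sub>m l \<and> V * transpose_mat V = 1\<^sub>m l"

section \<open>Kernels and their reproducing kernel Hilbert spaces\<close>

definition kernel_mat :: "('a \<Rightarrow> 'a \<Rightarrow> real) \<Rightarrow> nat \<Rightarrow> (nat \<Rightarrow> 'a) \<Rightarrow> real mat" where
  "kernel_mat k l Z = Matrix.mat l l (\<lambda>(i, j). k (Z i) (Z j))"

definition kernel_vec :: "('a \<Rightarrow> 'a \<Rightarrow> real) \<Rightarrow> nat \<Rightarrow> (nat \<Rightarrow> 'a) \<Rightarrow> 'a \<Rightarrow> real Matrix.vec" where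
  "kernel_vec k l Z x = Matrix.vec l (\<lambda>i. k (Z i) x)"

definition positive_definite_kernel :: "('a \<Rightarrow> 'a \<Rightarrow> real) \<Rightarrow> bool" where
  "positive_definite_kernel k \<longleftrightarrow> (\<forall>n Z. positive_semidefinite (kernel_mat k n Z))"

text \<open>A real Hilbert space of functions: carrier \<open>S\<close> with pointwise operations and inner product \<open>ip\<close>.
  Values of \<open>ip\<close> outside \<open>S\<close> are irrelevant.\<close>

definition function_hilbert_space ::
  "('a \<Rightarrow> real) set \<Rightarrow> (('a \<Rightarrow> real) \<Rightarrow> ('a \<Rightarrow> real) \<Rightarrow> real) \<Rightarrow> bool" where
  "function_hilbert_space S ip \<longleftrightarrow>
     (\<lambda>x. 0) \<in> S \<and>
     (\<forall>f\<in>S. \<forall>g\<in>S. (\<lambda>x. f x + g x) \<in> S) \<and>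
     (\<forall>c. \<forall>f\<in>S. (\<lambda>x. c * f x) \<in> S) \<and>
     (\<forall>f\<in>S. \<forall>g\<in>S. ip f g = ip g f) \<and>
     (\<forall>f\<in>S. \<forall>g\<in>S. \<forall>h\<in>S. ip (\<lambda>x. f x + g x) h = ip f h + ip g h) \<and>
     (\<forall>c. \<forall>f\<in>S. \<forall>g\<in>S. ip (\<lambda>x. c * f x) g = c * ip f g) \<and>
     (\<forall>f\<in>S. 0 \<le> ip f f) \<and>
     (\<forall>f\<in>S. ip f f = 0 \<longrightarrow> f = (\<lambda>x. 0)) \<and>
     Metric_space.mcomplete S (\<lambda>f g. sqrt (ip (\<lambda>x. f x - g x) (\<lambda>x. f x - g x)))"

text \<open>By Moore-Aronszajn, a positive definite \<open>k\<close> has exactly one such space (\<open>S\<close> together with \<open>ip\<close>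
  on \<open>S\<close>).\<close>

definition is_rkhs ::
  "('a \<Rightarrow> 'a \<Rightarrow> real) \<Rightarrow> ('a \<Rightarrow> real) set \<Rightarrow> (('a \<Rightarrow> real) \<Rightarrow> ('a \<Rightarrow> real) \<Rightarrow> real) \<Rightarrow> bool" where
  "is_rkhs k S ip \<longleftrightarrow>
     function_hilbert_space S ip \<and>
     (\<forall>x. k x \<in> S) \<and> (\<forall>f\<in>S. \<forall>x. f x = ip f (k x))"

text \<open>Orthonormal family, indexed by \<open>I\<close>, with dense linear span.\<close>

definition orthonormal_basis_on ::
  "('a \<Rightarrow> real) set \<Rightarrow> (('a \<Rightarrow> real) \<Rightarrow> ('a \<Rightarrow> real) \<Rightarrow> real) \<Rightarrow> 'i set \<Rightarrow> ('i \<Rightarrow> 'a \<Rightarrow> real) \<Rightarrow> bool" where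
  "orthonormal_basis_on S ip I g \<longleftrightarrow>
     (\<forall>i\<in>I. g i \<in> S) \<and>
     (\<forall>i\<in>I. \<forall>j\<in>I. ip (g i) (g j) = (if i = j then 1 else 0)) \<and>
     (\<forall>f\<in>S. \<forall>\<epsilon>>0. \<exists>J c. finite J \<and> J \<subseteq> I \<and>
        sqrt (ip (\<lambda>x. f x - (\<Sum>i\<in>J. c i * g i x)) (\<lambda>x. f x - (\<Sum>i\<in>J. c i * g i x))) < \<epsilon>)"

section \<open>The integral operator\<close>

definition square_integrable :: "'a measure \<Rightarrow> ('a \<Rightarrow> real) \<Rightarrow> bool" where
  "square_integrable M f \<longleftrightarrow> f \<in> borel_measurable M \<and> integrable M (\<lambda>x. (f x)\<^sup>2)"

definition orthonormal_L2 :: "'a measure \<Rightarrow> (nat \<Rightarrow> 'a \<Rightarrow> real) \<Rightarrow> bool" where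
  "orthonormal_L2 M e \<longleftrightarrow>
     (\<forall>i. square_integrable M (e i)) \<and>
     (\<forall>i j. (\<integral>x. e i x * e j x \<partial>M) = (if i = j then 1 else 0))"

definition integral_operator ::
  "'a measure \<Rightarrow> ('a \<Rightarrow> 'a \<Rightarrow> real) \<Rightarrow> ('a \<Rightarrow> real) \<Rightarrow> 'a \<Rightarrow> real" where
  "integral_operator M k f x = (\<integral>y. k x y * f y \<partial>M)"

section \<open>The approximate kernels\<close>

definition h_kernel :: "'a measure \<Rightarrow> ('a \<Rightarrow> 'a \<Rightarrow> real) \<Rightarrow> 'a \<Rightarrow> 'a \<Rightarrow> real" where
  "h_kernel M k x y = (\<integral>t. k x t * k t y \<partial>M)"

definition nystrom_fun ::
  "('a \<Rightarrow> 'a \<Rightarrow> real) \<Rightarrow> nat \<Rightarrow> (nat \<Rightarrow> 'a) \<Rightarrow> real mat \<Rightarrow> real mat \<Rightarrow> nat \<Rightarrow> 'a \<Rightarrow> real" where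
  "nystrom_fun k l Z H V i x = scalar_prod (pinv H *\<^sub>v col V i) (kernel_vec k l Z x)"

definition nystrom_kernel_trunc ::
  "('a \<Rightarrow> 'a \<Rightarrow> real) \<Rightarrow> nat \<Rightarrow> (nat \<Rightarrow> 'a) \<Rightarrow> real mat \<Rightarrow> real mat \<Rightarrow> (nat \<Rightarrow> real) \<Rightarrow> nat
     \<Rightarrow> 'a \<Rightarrow> 'a \<Rightarrow> real" where
  "nystrom_kernel_trunc k l Z H V \<kappa> s x y =
     (\<Sum>i<s. \<kappa> i * nystrom_fun k l Z H V i x * nystrom_fun k l Z H V i y)"

definition nystrom_kernel ::
  "('a \<Rightarrow> 'a \<Rightarrow> real) \<Rightarrow> nat \<Rightarrow> (nat \<Rightarrow> 'a) \<Rightarrow> real mat \<Rightarrow> real mat \<Rightarrow> (nat \<Rightarrow> real)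
     \<Rightarrow> 'a \<Rightarrow> 'a \<Rightarrow> real" where
  "nystrom_kernel k l Z H V \<kappa> x y =
     (\<Sum>i<l. \<kappa> i * nystrom_fun k l Z H V i x * nystrom_fun k l Z H V i y)"

end

theory Submission
  imports Defs "Jordan_Normal_Form.Determinant"
begin

text \<open>The matrix \<open>H H\<^sup>+\<close> is an orthogonal projection and \<open>H\<^sup>T H = h\<^sub>\<mu>(Z, Z)\<close>, so
  \<open>\<integral> f\<^sub>i\<^sup>2 d\<mu> = |H H\<^sup>+ v\<^sub>i|\<^sup>2 \<le> 1\<close>, and it suffices to show \<open>\<kappa>\<^sub>i \<le> \<sigma>\<^sub>i\<close>. This is a
  Courant-Fischer argument: every \<open>u\<close> in the span of \<open>v\<^sub>0, \<dots>, v\<^sub>i\<close> yields a function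
  \<open>g = \<Sum>\<^sub>a w\<^sub>a k(z\<^sub>a, \<cdot>)\<close> with \<open>w = k(Z, Z)\<^sup>+ H\<^sup>T u\<close>, whose squared norms in the reproducing kernel
  Hilbert space and in \<open>L\<^sup>2(\<mu>)\<close> are \<open>\<Sum> \<kappa>\<^sub>p c\<^sub>p\<^sup>2\<close> and \<open>\<Sum> \<kappa>\<^sub>p\<^sup>2 c\<^sub>p\<^sup>2\<close>, where \<open>c\<close> are the
  coordinates of \<open>u\<close>. Counting dimensions, some \<open>u \<noteq> 0\<close> makes \<open>g\<close> orthogonal to
  \<open>e\<^sub>0, \<dots>, e\<^sub>i\<^sub>-\<^sub>1\<close>; for it the \<open>L\<^sup>2\<close> norm squared is at most \<open>\<sigma>\<^sub>i\<close> times, and at least \<open>\<kappa>\<^sub>i\<close>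
  times, the Hilbert space norm squared.\<close>

unbundle no vec_syntax

section \<open>Moore-Penrose inverses\<close>

text \<open>The m equations are padded with zero rows to a square system. Since m < n, row m is one
  of these, so the determinant vanishes and the kernel is nontrivial. This is the dimension count
  for annihilating polynomials and for the Courant-Fischer step.\<close>

lemma exists_nonzero_solution:
  fixes f :: "nat \<Rightarrow> nat \<Rightarrow> 'a::field"
  assumes "m < n"
  shows "\<exists>c. (\<exists>j<n. c j \<noteq> 0) \<and> (\<forall>i<m. (\<Sum>j<n. f i j * c j) = 0)"
proof -
  define A where "A = Matrix.mat n n (\<lambda>(i, j). if i < m then f i j else 0)"
  have A: "A \<in> carrier_mat n n" by (simp add: A_def)
  have "A = mat\<^sub>r n n (\<lambda>i. if i = m then 0\<^sub>v n else row A i)"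
    using A by (intro eq_rowI) (auto simp: A_def)
  then have "det A = 0"
    using det_row_0[OF assms, of "row A"] A by (auto simp: Pi_I)
  then obtain v where v: "v \<in> carrier_vec n" "v \<noteq> 0\<^sub>v n" "A *\<^sub>v v = 0\<^sub>v n"
    using det_0_iff_vec_prod_zero_field[OF A] by blast
  have "(\<Sum>j<n. f i j * v $ j) = 0" if "i < m" for i
  proof -
    have "(A *\<^sub>v v) $ i = 0" using v that assms by simp
    then show ?thesis using that assms v A
      by (simp add: scalar_prod_def A_def lessThan_atLeast0)
  qed
  moreover have "\<exists>j<n. v $ j \<noteq> 0" using v by (metis carrier_vecD eq_vecI index_zero_vec)
  ultimately show ?thesis by blast
qed

lemma scalar_prod_self_nonneg: "0 \<le> scalar_prod v (v :: real Matrix.vec)"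
  by (simp add: scalar_prod_def sum_nonneg)

lemma scalar_prod_self_eq_0:
  assumes "v \<in> carrier_vec n" "scalar_prod v (v :: real Matrix.vec) = 0"
  shows "v = 0\<^sub>v n"
proof -
  have "\<forall>i\<in>{0..<n}. v $ i * v $ i = 0"
    using assms by (subst sum_nonneg_eq_0_iff[symmetric]) (auto simp: scalar_prod_def)
  then show ?thesis using assms by (intro eq_vecI) auto
qed

lemma scalar_prod_mult_mat_vec:
  fixes A :: "'a::comm_semiring_0 mat"
  assumes "A \<in> carrier_mat m n" "v \<in> carrier_vec m" "w \<in> carrier_vec n"
  shows "scalar_prod v (A *\<^sub>v w) = scalar_prod (transpose_mat A *\<^sub>v v) w"
  using transpose_vec_mult_scalar[OF assms(1,3,2)] assms
  by simp

text \<open>For a column \<open>u = A *\<^sub>v x\<close> of \<open>A * X\<close>, the inner product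
  of u with itself equals that of \<open>transpose_mat A *\<^sub>v u\<close> with x, which is 0;
  over the reals this forces u = 0.\<close>

lemma transpose_mult_self_cancel:
  fixes A X :: "real mat"
  assumes A: "A \<in> carrier_mat m n" and X: "X \<in> carrier_mat n p"
    and eq: "transpose_mat A * (A * X) = 0\<^sub>m n p"
  shows "A * X = 0\<^sub>m m p"
proof (rule eq_matI)
  fix i j assume "i < dim_row (0\<^sub>m m p :: real mat)" "j < dim_col (0\<^sub>m m p :: real mat)"
  then have ij: "i < m" "j < p" by auto
  have AX: "A * X \<in> carrier_mat m p" using A X by simp
  define u where "u = col (A * X) j"
  have u: "u \<in> carrier_vec m" "u = A *\<^sub>v col X j"
    using A X ij by (auto simp: u_def)
  have "transpose_mat A *\<^sub>v u = col (transpose_mat A * (A * X)) j"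
    using A col_mult2[of "transpose_mat A" n m "A * X" p j] AX ij by (simp add: u_def)
  then have "transpose_mat A *\<^sub>v u = 0\<^sub>v n" using eq ij by simp
  then have "scalar_prod u u = 0"
    using scalar_prod_mult_mat_vec[OF A u(1), of "col X j"] u X ij by simp
  then have "u = 0\<^sub>v m" using scalar_prod_self_eq_0 u by blast
  then have "u $ i = 0" using ij by simp
  then show "(A * X) $$ (i, j) = 0\<^sub>m m p $$ (i, j)"
    using ij A X index_col[of i "A * X" j] by (simp add: u_def del: index_mult_mat(1) index_col)
qed (use A X in auto)

section \<open>Polynomials in a square matrix\<close>

text \<open>Coefficients are listed from the constant term upwards, so each zero at the head of the
  list amounts to one factor B in front of the remaining polynomial.\<close>

fun horner_mat :: "'a::comm_ring_1 mat \<Rightarrow> 'a list \<Rightarrow> 'a mat" where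
  "horner_mat B [] = 0\<^sub>m (dim_row B) (dim_row B)"
| "horner_mat B (c # cs) = c \<cdot>\<^sub>m 1\<^sub>m (dim_row B) + B * horner_mat B cs"

lemma horner_mat_carrier:
  assumes "B \<in> carrier_mat n n"
  shows "horner_mat B cs \<in> carrier_mat n n"
  using assms by (induction cs) auto

lemma horner_mat_commutes:
  assumes B: "B \<in> carrier_mat n n"
  shows "B * horner_mat B cs = horner_mat B cs * B"
proof (induction cs)
  case Nil
  then show ?case using B by simp
next
  case (Cons c cs)
  note H = horner_mat_carrier[OF B, of cs]
  have "B * (c \<cdot>\<^sub>m 1\<^sub>m n + B * horner_mat B cs) = c \<cdot>\<^sub>m B + B * (B * horner_mat B cs)"
    using B H by (subst mult_add_distrib_mat[where nr = n and n = n and nc = n])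
      (auto simp: mult_smult_distrib[where nr = n and n = n and nc = n])
  also have "\<dots> = c \<cdot>\<^sub>m B + (B * horner_mat B cs) * B"
    using assoc_mult_mat[OF B H B] Cons.IH by simp
  also have "\<dots> = (c \<cdot>\<^sub>m 1\<^sub>m n + B * horner_mat B cs) * B"
    using B H by (subst add_mult_distrib_mat[where nr = n and n = n and nc = n])
      (auto simp: mult_smult_assoc_mat[where nr = n and n = n and nc = n])
  finally show ?case using B by simp
qed

text \<open>Transposition reverses the product of B with a polynomial in B, and commutation restores
  the order.\<close>

lemma horner_mat_symmetric:
  assumes B: "B \<in> carrier_mat n n" and sym: "transpose_mat B = B"
  shows "transpose_mat (horner_mat B cs) = horner_mat B cs"
proof (induction cs)
  case Nil
  then show ?case using B by simp
next
  case (Cons c cs)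
  note H = horner_mat_carrier[OF B, of cs]
  have 1: "transpose_mat (B * horner_mat B cs) = B * horner_mat B cs"
    using transpose_mult[OF B H] Cons.IH sym horner_mat_commutes[OF B, of cs] by simp
  have 2: "transpose_mat (c \<cdot>\<^sub>m 1\<^sub>m n) = c \<cdot>\<^sub>m 1\<^sub>m n" by auto
  show ?case using B H by (simp add: transpose_add[where nr = n and nc = n] 1 2)
qed

text \<open>Each entry is linear in the coefficients, with entries of powers of B as factors.
  Annihilating B thus becomes a homogeneous linear system for the coefficients.\<close>

lemma horner_mat_index:
  assumes B: "B \<in> carrier_mat n n" and ij: "i < n" "j < n"
  shows "horner_mat B cs $$ (i, j)
    = (\<Sum>p<length cs. ((\<lambda>X. B * X) ^^ p) (1\<^sub>m n) $$ (i, j) * cs ! p)"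
  using ij
proof (induction cs arbitrary: i)
  case Nil
  then show ?case using B by simp
next
  case (Cons c cs)
  have W: "((\<lambda>X. B * X) ^^ p) (1\<^sub>m n) \<in> carrier_mat n n" for p
    using B by (induction p) auto
  note H = horner_mat_carrier[OF B, of cs]
  have "(B * horner_mat B cs) $$ (i, j) = (\<Sum>q = 0..<n. B $$ (i, q) * horner_mat B cs $$ (q, j))"
    using Cons.prems B H by (simp add: scalar_prod_def)
  also have "\<dots> = (\<Sum>q = 0..<n. \<Sum>p<length cs.
      B $$ (i, q) * (((\<lambda>X. B * X) ^^ p) (1\<^sub>m n) $$ (q, j) * cs ! p))"
    using Cons by (simp add: sum_distrib_left)
  also have "\<dots> = (\<Sum>p<length cs. \<Sum>q = 0..<n.
      B $$ (i, q) * (((\<lambda>X. B * X) ^^ p) (1\<^sub>m n) $$ (q, j) * cs ! p))"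
    by (rule sum.swap)
  also have "\<dots> = (\<Sum>p<length cs. ((\<lambda>X. B * X) ^^ Suc p) (1\<^sub>m n) $$ (i, j) * cs ! p)"
  proof (rule sum.cong[OF refl])
    fix p
    have "((\<lambda>X. B * X) ^^ Suc p) (1\<^sub>m n) $$ (i, j)
        = (\<Sum>q = 0..<n. B $$ (i, q) * ((\<lambda>X. B * X) ^^ p) (1\<^sub>m n) $$ (q, j))"
      using Cons.prems B W[of p] by (auto simp: scalar_prod_def)
    then show "(\<Sum>q = 0..<n. B $$ (i, q) * (((\<lambda>X. B * X) ^^ p) (1\<^sub>m n) $$ (q, j) * cs ! p))
        = ((\<lambda>X. B * X) ^^ Suc p) (1\<^sub>m n) $$ (i, j) * cs ! p"
      by (simp add: sum_distrib_right mult.assoc)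
  qed
  finally have "(B * horner_mat B cs) $$ (i, j)
    = (\<Sum>p<length cs. ((\<lambda>X. B * X) ^^ Suc p) (1\<^sub>m n) $$ (i, j) * cs ! p)" .
  moreover have "horner_mat B (c # cs) $$ (i, j)
    = 1\<^sub>m n $$ (i, j) * c + (B * horner_mat B cs) $$ (i, j)"
    using Cons.prems B H by (simp del: index_mult_mat(1))
  moreover have "(\<Sum>p<length (c # cs). ((\<lambda>X. B * X) ^^ p) (1\<^sub>m n) $$ (i, j) * (c # cs) ! p)
    = 1\<^sub>m n $$ (i, j) * c
      + (\<Sum>p<length cs. ((\<lambda>X. B * X) ^^ Suc p) (1\<^sub>m n) $$ (i, j) * cs ! p)"
    unfolding length_Cons sum.lessThan_Suc_shift by simp
  ultimately show ?case by simp
qed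

text \<open>There is one equation for each of the n * n entries, while a polynomial of degree at
  most n * n has n * n + 1 coefficients.\<close>

lemma horner_mat_annihilator:
  assumes B: "(B :: 'a::field mat) \<in> carrier_mat n n"
  shows "\<exists>cs. (\<exists>c\<in>set cs. c \<noteq> 0) \<and> horner_mat B cs = 0\<^sub>m n n"
proof -
  \<comment> \<open>The equation numbered q stands for the matrix entry in row
    \<open>q div n\<close> and column \<open>q mod n\<close>.\<close>
  define f where "f q p = ((\<lambda>X. B * X) ^^ p) (1\<^sub>m n) $$ (q div n, q mod n)" for q p
  obtain c where c: "\<exists>p<Suc (n * n). c p \<noteq> 0"
    "\<And>q. q < n * n \<Longrightarrow> (\<Sum>p<Suc (n * n). f q p * c p) = 0"
    using exists_nonzero_solution[OF lessI[of "n * n"], of f] by blast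
  define cs where "cs = map c [0..<Suc (n * n)]"
  have len: "length cs = Suc (n * n)" and nth: "p < Suc (n * n) \<Longrightarrow> cs ! p = c p" for p
    unfolding cs_def by (simp, metis diff_zero length_upt nth_map nth_upt add_0)
  have "horner_mat B cs $$ (i, j) = 0" if ij: "i < n" "j < n" for i j
  proof -
    have "i * n + j < n * n"
    proof -
      have "i * n + j < Suc i * n" using ij by simp
      also have "\<dots> \<le> n * n" using ij by (intro mult_right_mono) auto
      finally show ?thesis .
    qed
    moreover have "(i * n + j) div n = i" "(i * n + j) mod n = j" using ij by auto
    ultimately have "(\<Sum>p<Suc (n * n). ((\<lambda>X. B * X) ^^ p) (1\<^sub>m n) $$ (i, j) * c p) = 0"
      using c(2)[of "i * n + j"] by (simp add: f_def del: sum.lessThan_Suc)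
    then show ?thesis unfolding horner_mat_index[OF B ij] len
      by (subst sum.cong[OF refl, of _ _ "\<lambda>p. ((\<lambda>X. B * X) ^^ p) (1\<^sub>m n) $$ (i, j) * c p"])
        (simp_all add: nth del: sum.lessThan_Suc)
  qed
  then have "horner_mat B cs = 0\<^sub>m n n" using horner_mat_carrier[OF B, of cs] by auto
  moreover have "\<exists>x\<in>set cs. x \<noteq> 0" using c(1) len nth by (metis nth_mem)
  ultimately show ?thesis by blast
qed

text \<open>If a polynomial \<open>x\<^sup>m (c + x q(x))\<close> with \<open>c \<noteq> 0\<close> annihilates \<open>B\<close>, symmetry of \<open>B\<close> lets one cancel
  all but one of the factors \<open>B\<close>, and \<open>G = -q(B)/c\<close> is a generalized inverse.\<close>

lemma symmetric_generalized_inverse: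
  assumes B: "(B :: real mat) \<in> carrier_mat n n" and sym: "transpose_mat B = B"
  shows "\<exists>G. G \<in> carrier_mat n n \<and> transpose_mat G = G \<and> B * G = G * B \<and> B * (G * B) = B"
proof -
  obtain cs where cs: "\<exists>c\<in>set cs. c \<noteq> 0" "horner_mat B cs = 0\<^sub>m n n"
    using horner_mat_annihilator[OF B] by blast
  obtain ys c ds where split: "cs = ys @ c # ds" "c \<noteq> 0" "\<forall>y\<in>set ys. \<not> y \<noteq> 0"
    using split_list_first_prop[OF cs(1)] by blast
  note car = horner_mat_carrier[OF B]
  \<comment> \<open>Leading zero coefficients are stripped one at a time. The extra factor B in
    front is what survives: for symmetric B, the cancellation law passes from B B X = 0 to B X = 0
    but no further.\<close>
  have cancel: "B * horner_mat B xs = 0\<^sub>m n n"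
    if "\<forall>y\<in>set ys. \<not> y \<noteq> 0" "B * horner_mat B (ys @ xs) = 0\<^sub>m n n" for ys xs
    using that
  proof (induction ys)
    case Nil
    then show ?case by simp
  next
    case (Cons y ys)
    have "horner_mat B ((y # ys) @ xs) = B * horner_mat B (ys @ xs)"
      using Cons.prems(1) B car[of "ys @ xs"] by auto
    then have "transpose_mat B * (B * horner_mat B (ys @ xs)) = 0\<^sub>m n n"
      using Cons.prems sym by simp
    then show ?case
      using transpose_mult_self_cancel[OF B car] Cons by simp
  qed
  have "B * horner_mat B cs = 0\<^sub>m n n" using cs B by simp
  then have Bc: "B * horner_mat B (c # ds) = 0\<^sub>m n n" using cancel split by blast
  define D where "D = horner_mat B ds"
  have D: "D \<in> carrier_mat n n" "transpose_mat D = D" "B * D = D * B"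
    using car horner_mat_symmetric[OF B sym] horner_mat_commutes[OF B] by (auto simp: D_def)
  have "B * (c \<cdot>\<^sub>m 1\<^sub>m n + B * D) = c \<cdot>\<^sub>m B + B * (B * D)"
    using B D by (subst mult_add_distrib_mat[where nr = n and n = n and nc = n])
      (auto simp: mult_smult_distrib[where nr = n and n = n and nc = n])
  then have *: "c \<cdot>\<^sub>m B + B * (B * D) = 0\<^sub>m n n" using Bc B by (simp add: D_def)
  \<comment> \<open>Dividing c B + B B D = 0 by -c, with D commuting with B, shows that -D/c
    satisfies B G B = B.\<close>
  define G where "G = (- 1 / c) \<cdot>\<^sub>m D"
  have GB: "G * B = (- 1 / c) \<cdot>\<^sub>m (B * D)" unfolding G_def
    using mult_smult_assoc_mat[OF D(1) B] D by simp
  have BG: "B * G = (- 1 / c) \<cdot>\<^sub>m (B * D)" unfolding G_def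
    using mult_smult_distrib[OF B D(1)] by simp
  have "B * (G * B) = (- 1 / c) \<cdot>\<^sub>m (B * (B * D))" unfolding GB
    using mult_smult_distrib[OF B, of "B * D" n] B D by simp
  also have "\<dots> = B"
  proof (rule eq_matI)
    fix i j assume "i < dim_row B" "j < dim_col B"
    then have ij: "i < n" "j < n" using B by auto
    have "(c \<cdot>\<^sub>m B + B * (B * D)) $$ (i, j) = 0" unfolding * using ij by simp
    then have "c * B $$ (i, j) + (B * (B * D)) $$ (i, j) = 0" using ij B D
      by (simp del: index_mult_mat(1))
    then have "(B * (B * D)) $$ (i, j) = - c * B $$ (i, j)" by simp
    then show "((- 1 / c) \<cdot>\<^sub>m (B * (B * D))) $$ (i, j) = B $$ (i, j)"
      using ij B D split(2) by (simp del: index_mult_mat(1))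
  qed (use B D in auto)
  finally have "B * (G * B) = B" .
  moreover have "transpose_mat G = (- 1 / c) \<cdot>\<^sub>m transpose_mat D" unfolding G_def by auto
  then have "transpose_mat G = G" using D by (simp add: G_def)
  moreover have "G \<in> carrier_mat n n" using D by (simp add: G_def)
  moreover have "B * G = G * B" using GB BG by simp
  ultimately show ?thesis by blast
qed

section \<open>Existence, uniqueness and transposition of the Moore-Penrose inverse\<close>

text \<open>The normal matrix \<open>transpose_mat A * A\<close> is symmetric and so has a commuting
  symmetric generalized inverse G, from which an inverse of A is assembled.\<close>

lemma is_moore_penrose_exists:
  assumes A: "(A :: real mat) \<in> carrier_mat m n"
  shows "\<exists>X. is_moore_penrose A X"
proof -
  define B where "B = transpose_mat A * A"
  have At: "transpose_mat A \<in> carrier_mat n m" using A by simp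
  have B: "B \<in> carrier_mat n n" using A by (simp add: B_def)
  have "transpose_mat B = B" unfolding B_def using transpose_mult[OF At A] by simp
  then obtain G where G: "G \<in> carrier_mat n n" "transpose_mat G = G"
    and comm: "B * G = G * B" and BGB: "B * (G * B) = B"
    using symmetric_generalized_inverse[OF B] by blast
  have GB: "G * B \<in> carrier_mat n n" and GAt: "G * transpose_mat A \<in> carrier_mat n m"
    and BGAt: "B * (G * transpose_mat A) \<in> carrier_mat n m"
    using G B At by auto
  have AGB: "A * (G * B) = A"
  proof -
    have D: "G * B - 1\<^sub>m n \<in> carrier_mat n n" by (simp add: minus_carrier_mat)
    \<comment> \<open>The identity B G B = B is lifted to A G B = A by cancelling a factor
      \<open>transpose_mat A\<close>.\<close>
    have "transpose_mat A * (A * (G * B - 1\<^sub>m n)) = B * (G * B - 1\<^sub>m n)"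
      unfolding B_def using assoc_mult_mat[OF At A D] by (simp add: B_def)
    also have "\<dots> = B * (G * B) - B * 1\<^sub>m n"
      by (rule mult_minus_distrib_mat[OF B GB one_carrier_mat])
    also have "\<dots> = 0\<^sub>m n n" using BGB B by simp
    finally have "A * (G * B - 1\<^sub>m n) = 0\<^sub>m m n"
      by (rule transpose_mult_self_cancel[OF A D])
    then have "A * (G * B) - A = 0\<^sub>m m n"
      using mult_minus_distrib_mat[OF A GB one_carrier_mat] A by simp
    then have eq0: "(A * (G * B) - A) $$ (i, j) = 0" if "i < m" "j < n" for i j
      using that by simp
    show ?thesis
    proof (rule eq_matI)
      fix i j assume ij: "i < dim_row A" "j < dim_col A"
      then show "(A * (G * B)) $$ (i, j) = A $$ (i, j)"
        using eq0[of i j] A by (simp del: index_mult_mat(1))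
    qed (use A G B in auto)
  qed
  \<comment> \<open>With the factor G B in front of \<open>G * transpose_mat A\<close>, the equation
    X A X = X reduces to B G B = B.\<close>
  define X where "X = G * (B * (G * transpose_mat A))"
  have X: "X \<in> carrier_mat n m" using G BGAt by (simp add: X_def)
  have "A * X = A * (G * B) * (G * transpose_mat A)"
    unfolding X_def using assoc_mult_mat[OF A GB GAt] assoc_mult_mat[OF G(1) B GAt] by simp
  then have AX: "A * X = A * (G * transpose_mat A)" using AGB by simp
  have "transpose_mat (A * X) = transpose_mat (G * transpose_mat A) * transpose_mat A"
    unfolding AX by (rule transpose_mult[OF A GAt])
  also have "transpose_mat (G * transpose_mat A) = A * G"
    using transpose_mult[OF G(1) At] G by simp
  also have "A * G * transpose_mat A = A * X"
    unfolding AX by (rule assoc_mult_mat[OF A G(1) At])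
  finally have AX_sym: "transpose_mat (A * X) = A * X" .
  have "X * A = G * (B * (G * transpose_mat A) * A)"
    unfolding X_def by (rule assoc_mult_mat[OF G(1) BGAt A])
  also have "B * (G * transpose_mat A) * A = B * (G * B)"
    using assoc_mult_mat[OF B GAt A] assoc_mult_mat[OF G(1) At A] by (simp add: B_def)
  finally have XA: "X * A = G * B" using BGB by simp
  then have XA_sym: "transpose_mat (X * A) = X * A"
    using transpose_mult[OF G(1) B] G comm \<open>transpose_mat B = B\<close> by simp
  have AXA: "A * X * A = A" using assoc_mult_mat[OF A X A] XA AGB by simp
  have "X * A * X = G * (B * (G * (B * (G * transpose_mat A))))"
    unfolding XA using assoc_mult_mat[OF G(1) B X] by (simp add: X_def)
  also have "G * (B * (G * transpose_mat A)) = G * B * (G * transpose_mat A)"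
    using assoc_mult_mat[OF G(1) B GAt] by simp
  also have "B * \<dots> = B * (G * transpose_mat A)"
    using assoc_mult_mat[OF B GB GAt] BGB by simp
  finally have "X * A * X = X" by (simp add: X_def)
  then show ?thesis unfolding is_moore_penrose_def
    using AX_sym XA_sym AXA X A by (intro exI[of _ X]) auto
qed

text \<open>From A X = (A Y)(A X), transposing the symmetric factors swaps them and gives A X = A Y;
  likewise X A = Y A. Then X = X A X = Y A X = Y A Y = Y.\<close>

lemma is_moore_penrose_unique:
  assumes "is_moore_penrose A X" "is_moore_penrose A Y"
  shows "X = Y"
proof -
  define m n where "m = dim_row A" "n = dim_col A"
  have A: "A \<in> carrier_mat m n" by (simp add: m_n_def)
  have X: "X \<in> carrier_mat n m" "A * X * A = A" "X * A * X = X"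
    "transpose_mat (A * X) = A * X" "transpose_mat (X * A) = X * A"
    and Y: "Y \<in> carrier_mat n m" "A * Y * A = A" "Y * A * Y = Y"
    "transpose_mat (A * Y) = A * Y" "transpose_mat (Y * A) = Y * A"
    using assms by (auto simp: is_moore_penrose_def m_n_def)
  have AX: "A * X \<in> carrier_mat m m" and AY: "A * Y \<in> carrier_mat m m"
    and XA: "X * A \<in> carrier_mat n n" and YA: "Y * A \<in> carrier_mat n n"
    using A X Y by auto
  have "A * X = A * Y * (A * X)" using assoc_mult_mat[OF AY A X(1)] Y(2) by simp
  then have "transpose_mat (A * X) = transpose_mat (A * X) * transpose_mat (A * Y)"
    using transpose_mult[OF AY AX] by simp
  then have "A * X = A * X * (A * Y)" using X(4) Y(4) by simp
  also have "\<dots> = A * Y" using assoc_mult_mat[OF AX A Y(1)] X(2) by simp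
  finally have 1: "A * X = A * Y" .
  have "X * A = X * A * (Y * A)"
    using assoc_mult_mat[OF X(1) A YA] assoc_mult_mat[OF A Y(1) A] Y(2) by simp
  then have "transpose_mat (X * A) = transpose_mat (Y * A) * transpose_mat (X * A)"
    using transpose_mult[OF XA YA] by simp
  then have "X * A = Y * A * (X * A)" using X(5) Y(5) by simp
  also have "\<dots> = Y * A"
    using assoc_mult_mat[OF Y(1) A XA] assoc_mult_mat[OF A X(1) A] X(2) by simp
  finally have 2: "X * A = Y * A" .
  have "X = Y * A * X" using X(3) 2 by simp
  also have "\<dots> = Y * (A * Y)" using assoc_mult_mat[OF Y(1) A X(1)] 1 by simp
  also have "\<dots> = Y" using assoc_mult_mat[OF Y(1) A Y(1)] Y(3) by simp
  finally show ?thesis .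
qed

lemma is_moore_penrose_pinv: "is_moore_penrose A (pinv A)"
proof -
  have "\<exists>!X. is_moore_penrose A X"
    using is_moore_penrose_exists[OF carrier_mat_triv] is_moore_penrose_unique by blast
  then show ?thesis unfolding pinv_def by (rule theI')
qed

lemma pinv_props:
  assumes "A \<in> carrier_mat m n"
  shows "pinv A \<in> carrier_mat n m" "A * pinv A * A = A" "pinv A * A * pinv A = pinv A"
    "transpose_mat (A * pinv A) = A * pinv A" "transpose_mat (pinv A * A) = pinv A * A"
  using is_moore_penrose_pinv[of A] assms by (auto simp: is_moore_penrose_def)

text \<open>Transposition permutes the Penrose equations, so uniqueness applies. It makes the
  pseudo-inverse of a symmetric Gram matrix symmetric.\<close>

lemma transpose_pinv: "transpose_mat (pinv A) = pinv (transpose_mat A)"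
proof (rule is_moore_penrose_unique[OF _ is_moore_penrose_pinv])
  define m n where "m = dim_row A" "n = dim_col A"
  have A: "A \<in> carrier_mat m n" by (simp add: m_n_def)
  note P = pinv_props[OF A]
  have t: "transpose_mat A * transpose_mat (pinv A) = pinv A * A"
    "transpose_mat (pinv A) * transpose_mat A = A * pinv A"
    using transpose_mult[OF P(1) A] transpose_mult[OF A P(1)] P by simp_all
  have "transpose_mat (A * (pinv A * A)) = transpose_mat A"
    "transpose_mat (pinv A * (A * pinv A)) = transpose_mat (pinv A)"
    using assoc_mult_mat[OF A P(1) A] assoc_mult_mat[OF P(1) A P(1)] P by simp_all
  then have "pinv A * A * transpose_mat A = transpose_mat A"
    "A * pinv A * transpose_mat (pinv A) = transpose_mat (pinv A)"
    using transpose_mult[of A m n "pinv A * A" n] transpose_mult[of "pinv A" n m "A * pinv A" m] A P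
    by simp_all
  then show "is_moore_penrose (transpose_mat A) (transpose_mat (pinv A))"
    unfolding is_moore_penrose_def t using A P by simp
qed

text \<open>Since v and P v have inner product |P v|^2, expanding 0 <= |v - P v|^2 leaves |v|^2 - |P
  v|^2.\<close>

lemma scalar_prod_projection_le:
  assumes P: "(P :: real mat) \<in> carrier_mat n n" and "transpose_mat P = P" "P * P = P"
    and v: "v \<in> carrier_vec n"
  shows "scalar_prod (P *\<^sub>v v) (P *\<^sub>v v) \<le> scalar_prod v v"
proof -
  have Pv: "P *\<^sub>v v \<in> carrier_vec n" using P v by simp
  have "scalar_prod v (P *\<^sub>v (P *\<^sub>v v)) = scalar_prod (P *\<^sub>v v) (P *\<^sub>v v)"
    using scalar_prod_mult_mat_vec[OF P v Pv] assms by simp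
  then have eq: "scalar_prod v (P *\<^sub>v v) = scalar_prod (P *\<^sub>v v) (P *\<^sub>v v)"
    using assoc_mult_mat_vec[OF P P v] assms by simp
  have "0 \<le> scalar_prod (v - P *\<^sub>v v) (v - P *\<^sub>v v)" by (rule scalar_prod_self_nonneg)
  also have "\<dots> = scalar_prod v v - scalar_prod v (P *\<^sub>v v)
      - (scalar_prod (P *\<^sub>v v) v - scalar_prod (P *\<^sub>v v) (P *\<^sub>v v))"
    using v Pv by (simp add: minus_scalar_prod_distrib[where n = n] scalar_prod_minus_distrib[where n = n])
  also have "scalar_prod (P *\<^sub>v v) v = scalar_prod v (P *\<^sub>v v)"
    by (rule comm_scalar_prod[OF Pv v])
  finally show ?thesis using eq by simp
qed

section \<open>Orthonormal series and kernel sections\<close>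

lemma square_integrable_mult:
  assumes "square_integrable M f" "square_integrable M g"
  shows "integrable M (\<lambda>x. f x * g x)"
proof (rule Bochner_Integration.integrable_bound)
  show "integrable M (\<lambda>x. (f x)\<^sup>2 + (g x)\<^sup>2)" "(\<lambda>x. f x * g x) \<in> borel_measurable M"
    using assms by (auto simp: square_integrable_def)
  show "AE x in M. norm (f x * g x) \<le> norm ((f x)\<^sup>2 + (g x)\<^sup>2)"
  proof (rule AE_I2)
    fix x
    have "2 * (\<bar>f x\<bar> * \<bar>g x\<bar>) \<le> (f x)\<^sup>2 + (g x)\<^sup>2"
      using sum_squares_bound[of "\<bar>f x\<bar>" "\<bar>g x\<bar>"] by (simp add: mult.assoc)
    moreover have "0 \<le> \<bar>f x\<bar> * \<bar>g x\<bar>" by simp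
    ultimately have "\<bar>f x\<bar> * \<bar>g x\<bar> \<le> (f x)\<^sup>2 + (g x)\<^sup>2" by linarith
    then show "norm (f x * g x) \<le> norm ((f x)\<^sup>2 + (g x)\<^sup>2)"
      by (simp add: abs_mult)
  qed
qed

lemma integrable_sum_mult_self:
  fixes w :: "'b \<Rightarrow> real"
  assumes "\<And>a. a \<in> A \<Longrightarrow> square_integrable M (g a)"
  shows "integrable M (\<lambda>x. (\<Sum>a\<in>A. w a * g a x)\<^sup>2)"
    and "(\<integral>x. (\<Sum>a\<in>A. w a * g a x)\<^sup>2 \<partial>M) = (\<Sum>a\<in>A. \<Sum>b\<in>A. w a * w b * (\<integral>x. g a x * g b x \<partial>M))"
proof -
  have *: "(\<Sum>a\<in>A. w a * g a x)\<^sup>2 = (\<Sum>a\<in>A. \<Sum>b\<in>A. w a * w b * (g a x * g b x))" for x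
    by (simp add: power2_eq_square sum_product mult_ac)
  have i: "integrable M (\<lambda>x. w a * w b * (g a x * g b x))" if "a \<in> A" "b \<in> A" for a b
    using square_integrable_mult[OF assms assms] that by simp
  show "integrable M (\<lambda>x. (\<Sum>a\<in>A. w a * g a x)\<^sup>2)"
    unfolding * by (intro Bochner_Integration.integrable_sum i)
  show "(\<integral>x. (\<Sum>a\<in>A. w a * g a x)\<^sup>2 \<partial>M) = (\<Sum>a\<in>A. \<Sum>b\<in>A. w a * w b * (\<integral>x. g a x * g b x \<partial>M))"
  proof -
    have "(\<integral>x. (\<Sum>a\<in>A. w a * g a x)\<^sup>2 \<partial>M)
        = (\<Sum>a\<in>A. \<integral>x. (\<Sum>b\<in>A. w a * w b * (g a x * g b x)) \<partial>M)"
      unfolding * by (intro Bochner_Integration.integral_sum Bochner_Integration.integrable_sum i)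
    also have "\<dots> = (\<Sum>a\<in>A. \<Sum>b\<in>A. \<integral>x. w a * w b * (g a x * g b x) \<partial>M)"
      by (intro sum.cong refl Bochner_Integration.integral_sum i)
    finally show ?thesis by simp
  qed
qed

lemma integral_square_orthonormal_sum:
  assumes "orthonormal_L2 M e"
  shows "integrable M (\<lambda>x. (\<Sum>j<n. a j * e j x)\<^sup>2)"
    and "(\<integral>x. (\<Sum>j<n. a j * e j x)\<^sup>2 \<partial>M) = (\<Sum>j<n. (a j)\<^sup>2)"
proof -
  have sq: "square_integrable M (e j)"
    and int: "(\<integral>x. e i x * e j x \<partial>M) = (if i = j then 1 else 0)" for i j
    using assms by (auto simp: orthonormal_L2_def)
  show "integrable M (\<lambda>x. (\<Sum>j<n. a j * e j x)\<^sup>2)"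
    by (rule integrable_sum_mult_self(1)) (rule sq)
  have "(\<integral>x. (\<Sum>j<n. a j * e j x)\<^sup>2 \<partial>M)
      = (\<Sum>i<n. \<Sum>j<n. a i * a j * (\<integral>x. e i x * e j x \<partial>M))"
    by (rule integrable_sum_mult_self(2)) (rule sq)
  also have "\<dots> = (\<Sum>i<n. \<Sum>j<n. if i = j then (a i)\<^sup>2 else 0)"
    by (intro sum.cong refl) (auto simp: int power2_eq_square)
  also have "\<dots> = (\<Sum>j<n. (a j)\<^sup>2)" by simp
  finally show "(\<integral>x. (\<Sum>j<n. a j * e j x)\<^sup>2 \<partial>M) = (\<Sum>j<n. (a j)\<^sup>2)" .
qed

text \<open>Pointwise convergence is the form in which the Mercer expansion is available.
  Measurability of g is inherited from the partial sums, whose squared norms are at most B by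
  orthonormality.\<close>

lemma orthonormal_series_square_integrable:
  assumes on: "orthonormal_L2 M e"
    and sums: "\<And>x. (\<lambda>j. a j * e j x) sums g x"
    and bound: "\<And>n. (\<Sum>j<n. (a j)\<^sup>2) \<le> B"
  shows "square_integrable M g" and "(\<integral>x. (g x)\<^sup>2 \<partial>M) \<le> B"
proof -
  have meas_e: "e j \<in> borel_measurable M" for j
    using on by (simp add: orthonormal_L2_def square_integrable_def)
  define s where "s n x = (\<Sum>j<n. a j * e j x)" for n x
  have lim: "(\<lambda>n. s n x) \<longlonglongrightarrow> g x" for x
    using sums[of x] by (simp add: sums_def s_def)
  have meas_s[measurable]: "s n \<in> borel_measurable M" for n
    unfolding s_def using meas_e by measurable
  have meas: "g \<in> borel_measurable M"
    by (rule borel_measurable_LIMSEQ_real[OF lim]) (rule meas_s)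
  have B: "0 \<le> B" using bound[of 0] by simp
  \<comment> \<open>Fatou's lemma for the partial sums; convergence in \<open>L\<^sup>2\<close> is not needed.\<close>
  have "(\<integral>\<^sup>+x. ennreal ((g x)\<^sup>2) \<partial>M) = (\<integral>\<^sup>+x. liminf (\<lambda>n. ennreal ((s n x)\<^sup>2)) \<partial>M)"
  proof (rule nn_integral_cong)
    fix x
    have "(\<lambda>n. ennreal ((s n x)\<^sup>2)) \<longlonglongrightarrow> ennreal ((g x)\<^sup>2)"
      using lim by (intro tendsto_ennrealI tendsto_power)
    then show "ennreal ((g x)\<^sup>2) = liminf (\<lambda>n. ennreal ((s n x)\<^sup>2))"
      by (intro lim_imp_Liminf[symmetric]) auto
  qed
  also have "\<dots> \<le> liminf (\<lambda>n. \<integral>\<^sup>+x. ennreal ((s n x)\<^sup>2) \<partial>M)"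
    by (rule nn_integral_liminf) measurable
  also have "\<dots> \<le> liminf (\<lambda>n::nat. ennreal B)"
  proof (intro Liminf_mono always_eventually allI)
    fix n
    have "(\<integral>\<^sup>+x. ennreal ((s n x)\<^sup>2) \<partial>M) = ennreal (\<integral>x. (s n x)\<^sup>2 \<partial>M)"
      using integral_square_orthonormal_sum(1)[OF on, where n = n and a = a]
      by (intro nn_integral_eq_integral) (simp_all add: s_def)
    also have "\<dots> \<le> ennreal B"
      using integral_square_orthonormal_sum(2)[OF on, where n = n and a = a] bound[of n]
      by (intro ennreal_leI) (simp add: s_def)
    finally show "(\<integral>\<^sup>+x. ennreal ((s n x)\<^sup>2) \<partial>M) \<le> ennreal B" .
  qed
  also have "\<dots> = ennreal B" by (simp add: Liminf_const)
  finally have nn: "(\<integral>\<^sup>+x. ennreal ((g x)\<^sup>2) \<partial>M) \<le> ennreal B" .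
  have int: "integrable M (\<lambda>x. (g x)\<^sup>2)"
    using meas nn by (intro integrableI_bounded) (auto intro: le_less_trans)
  then show "square_integrable M g" using meas by (simp add: square_integrable_def)
  have "ennreal (\<integral>x. (g x)\<^sup>2 \<partial>M) \<le> ennreal B"
    using nn_integral_eq_integral[OF int] nn by simp
  then show "(\<integral>x. (g x)\<^sup>2 \<partial>M) \<le> B" using B by simp
qed

text \<open>The section at z has coefficients \<open>\<sigma> j * e j z\<close>. Bounding one factor
  \<open>\<sigma> j\<close> by \<open>\<sigma> 0\<close> compares their squares with the Mercer
  series of \<open>k z z\<close>.\<close>

lemma kernel_section_square_integrable:
  assumes on: "orthonormal_L2 M e"
    and \<sigma>: "\<And>i j. i \<le> j \<Longrightarrow> \<sigma> j \<le> \<sigma> i" "\<And>i. 0 \<le> \<sigma> i"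
    and mercer: "\<And>x y. (\<lambda>i. \<sigma> i * e i x * e i y) sums k x y"
  shows "square_integrable M (k z)"
proof (rule orthonormal_series_square_integrable(1)[OF on])
  show "(\<lambda>j. \<sigma> j * e j z * e j x) sums k z x" for x by (rule mercer)
  fix n
  have "(\<Sum>j<n. (\<sigma> j * e j z)\<^sup>2) \<le> (\<Sum>j<n. \<sigma> 0 * (\<sigma> j * e j z * e j z))"
  proof (rule sum_mono)
    fix j
    have "\<sigma> j * (\<sigma> j * (e j z)\<^sup>2) \<le> \<sigma> 0 * (\<sigma> j * (e j z)\<^sup>2)"
      using \<sigma> by (intro mult_right_mono) auto
    then show "(\<sigma> j * e j z)\<^sup>2 \<le> \<sigma> 0 * (\<sigma> j * e j z * e j z)"
      by (simp add: power2_eq_square mult_ac)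
  qed
  also have "\<dots> = \<sigma> 0 * (\<Sum>j<n. \<sigma> j * e j z * e j z)" by (simp add: sum_distrib_left)
  also have "\<dots> \<le> \<sigma> 0 * k z z"
    using \<sigma>(2) mercer[of z z] sum_le_suminf[of "\<lambda>i. \<sigma> i * e i z * e i z" "{..<n}"]
    by (intro mult_left_mono) (auto simp: sums_iff mult.assoc)
  finally show "(\<Sum>j<n. (\<sigma> j * e j z)\<^sup>2) \<le> \<sigma> 0 * k z z" .
qed

text \<open>Put \<beta>_j = sum of w_a e_j(Z_a). The combination has coefficients \<sigma>_j
  \<beta>_j, and its quadratic form is the sum of \<sigma>_j \<beta>_j^2. Terms with j < i vanish;
  in the others one factor \<sigma>_j is at most \<sigma>_i.\<close>

lemma kernel_combination_integral_le:
  assumes on: "orthonormal_L2 M e"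
    and \<sigma>: "\<And>i j. i \<le> j \<Longrightarrow> \<sigma> j \<le> \<sigma> i" "\<And>i. 0 \<le> \<sigma> i"
    and mercer: "\<And>x y. (\<lambda>i. \<sigma> i * e i x * e i y) sums k x y"
    and vanish: "\<And>j. j < i \<Longrightarrow> (\<Sum>a\<in>A. w a * e j (Z a)) = 0"
  shows "(\<integral>x. (\<Sum>a\<in>A. w a * k (Z a) x)\<^sup>2 \<partial>M)
    \<le> \<sigma> i * (\<Sum>a\<in>A. \<Sum>b\<in>A. w a * w b * k (Z a) (Z b))"
proof (rule orthonormal_series_square_integrable(2)[OF on])
  define \<beta> where "\<beta> j = (\<Sum>a\<in>A. w a * e j (Z a))" for j
  have "(\<lambda>j. \<Sum>a\<in>A. w a * (\<sigma> j * e j (Z a) * e j x)) sums (\<Sum>a\<in>A. w a * k (Z a) x)" for x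
    by (intro sums_sum sums_mult mercer)
  then show "(\<lambda>j. \<sigma> j * \<beta> j * e j x) sums (\<Sum>a\<in>A. w a * k (Z a) x)" for x
    by (simp add: \<beta>_def sum_distrib_left sum_distrib_right mult_ac)
  have "(\<lambda>j. \<Sum>a\<in>A. \<Sum>b\<in>A. w a * w b * (\<sigma> j * e j (Z a) * e j (Z b)))
      sums (\<Sum>a\<in>A. \<Sum>b\<in>A. w a * w b * k (Z a) (Z b))"
    by (intro sums_sum sums_mult mercer)
  moreover have "(\<Sum>a\<in>A. \<Sum>b\<in>A. w a * w b * (\<sigma> j * e j (Z a) * e j (Z b))) = \<sigma> j * (\<beta> j)\<^sup>2" for j
    by (simp add: \<beta>_def power2_eq_square sum_product sum_distrib_left mult_ac)
  ultimately have q: "(\<lambda>j. \<sigma> j * (\<beta> j)\<^sup>2) sums (\<Sum>a\<in>A. \<Sum>b\<in>A. w a * w b * k (Z a) (Z b))"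
    by simp
  fix n
  have "(\<Sum>j<n. (\<sigma> j * \<beta> j)\<^sup>2) \<le> (\<Sum>j<n. \<sigma> i * (\<sigma> j * (\<beta> j)\<^sup>2))"
  proof (rule sum_mono)
    fix j
    have "\<sigma> j * (\<sigma> j * (\<beta> j)\<^sup>2) \<le> \<sigma> i * (\<sigma> j * (\<beta> j)\<^sup>2)"
    proof (cases "j < i")
      case True
      then show ?thesis using vanish by (simp add: \<beta>_def)
    next
      case False
      then show ?thesis using \<sigma> by (intro mult_right_mono) auto
    qed
    then show "(\<sigma> j * \<beta> j)\<^sup>2 \<le> \<sigma> i * (\<sigma> j * (\<beta> j)\<^sup>2)"
      by (simp add: power2_eq_square mult_ac)
  qed
  also have "\<dots> = \<sigma> i * (\<Sum>j<n. \<sigma> j * (\<beta> j)\<^sup>2)" by (simp add: sum_distrib_left)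
  also have "\<dots> \<le> \<sigma> i * (\<Sum>a\<in>A. \<Sum>b\<in>A. w a * w b * k (Z a) (Z b))"
    using \<sigma>(2) q sum_le_suminf[of "\<lambda>j. \<sigma> j * (\<beta> j)\<^sup>2" "{..<n}"]
    by (intro mult_left_mono) (auto simp: sums_iff)
  finally show "(\<Sum>j<n. (\<sigma> j * \<beta> j)\<^sup>2) \<le> \<sigma> i * (\<Sum>a\<in>A. \<Sum>b\<in>A. w a * w b * k (Z a) (Z b))" .
qed

section \<open>The Nystroem eigenvalues\<close>

lemma scalar_prod_kernel_mat:
  assumes "w \<in> carrier_vec l"
  shows "scalar_prod w (kernel_mat k l Z *\<^sub>v w) = (\<Sum>a<l. \<Sum>b<l. w $ a * w $ b * k (Z a) (Z b))"
  using assms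
  by (simp add: kernel_mat_def scalar_prod_def lessThan_atLeast0 sum_distrib_left mult_ac)

text \<open>Expanding the square and using symmetry of k yields the quadratic form of
  \<open>h_kernel\<close> at w, which the factorization through H turns into |H w|^2.\<close>

lemma integral_square_kernel_combination:
  assumes sq: "\<And>z. square_integrable M (k z)" and sym: "\<And>x y. k x y = k y x"
    and H: "H \<in> carrier_mat m l"
    and H_factor: "transpose_mat H * H = kernel_mat (h_kernel M k) l Z"
    and w: "w \<in> carrier_vec l"
  shows "(\<integral>x. (\<Sum>a<l. w $ a * k (Z a) x)\<^sup>2 \<partial>M) = scalar_prod (H *\<^sub>v w) (H *\<^sub>v w)"
proof -
  have Hw: "H *\<^sub>v w \<in> carrier_vec m" using H w by simp
  have Ht: "transpose_mat H \<in> carrier_mat l m" using H by simp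
  have "(\<integral>x. (\<Sum>a<l. w $ a * k (Z a) x)\<^sup>2 \<partial>M)
      = (\<Sum>a<l. \<Sum>b<l. w $ a * w $ b * (\<integral>x. k (Z a) x * k (Z b) x \<partial>M))"
    by (rule integrable_sum_mult_self(2)) (rule sq)
  also have "\<dots> = scalar_prod w (kernel_mat (h_kernel M k) l Z *\<^sub>v w)"
    unfolding scalar_prod_kernel_mat[OF w] h_kernel_def
    by (intro sum.cong refl) (metis sym)
  also have "\<dots> = scalar_prod w (transpose_mat H *\<^sub>v (H *\<^sub>v w))"
    unfolding H_factor[symmetric] using assoc_mult_mat_vec[OF Ht H w] by simp
  also have "\<dots> = scalar_prod (H *\<^sub>v w) (H *\<^sub>v w)"
    using scalar_prod_mult_mat_vec[OF Ht w Hw] by simp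
  finally show ?thesis .
qed

lemma index_mat_diag_mult_vec:
  assumes "d \<in> carrier_vec l" "p < l"
  shows "(mat_diag l f *\<^sub>v d) $ p = f p * d $ p"
proof -
  have "(mat_diag l f *\<^sub>v d) $ p = (\<Sum>q = 0..<l. (if p = q then f q else 0) * d $ q)"
    using assms by (simp add: mat_diag_def scalar_prod_def)
  also have "\<dots> = (\<Sum>q = 0..<l. if q = p then f q * d $ q else 0)"
    by (rule sum.cong) auto
  finally show ?thesis using assms by simp
qed

lemma nystrom_eigenvalue_le:
  assumes on: "orthonormal_L2 M e"
    and \<sigma>: "\<And>i j. i \<le> j \<Longrightarrow> \<sigma> j \<le> \<sigma> i" "\<And>i. 0 \<le> \<sigma> i"
    and mercer: "\<And>x y. (\<lambda>i. \<sigma> i * e i x * e i y) sums k x y"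
    and H: "H \<in> carrier_mat l l"
    and H_factor: "transpose_mat H * H = kernel_mat (h_kernel M k) l Z"
    and V_orth: "orthogonal_matrix_of_size l V"
    and \<kappa>_decreasing: "\<And>i j. i \<le> j \<Longrightarrow> j < l \<Longrightarrow> \<kappa> j \<le> \<kappa> i"
    and decomposition:
      "H * pinv (kernel_mat k l Z) * transpose_mat H = V * mat_diag l \<kappa> * transpose_mat V"
    and i: "i < l"
  shows "\<kappa> i \<le> \<sigma> i"
\<comment> \<open>The main case needs \<open>\<kappa> i\<close> positive, since a weighted sum is
  cancelled at the end.\<close>
proof (cases "\<kappa> i \<le> 0")
  case True
  then show ?thesis using \<sigma>(2)[of i] by linarith
next
  case False
  have sq: "square_integrable M (k z)" for z
    by (rule kernel_section_square_integrable[OF on \<sigma> mercer])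
  have sym: "k x y = k y x" for x y
    using mercer[of x y] mercer[of y x] by (simp add: sums_iff mult_ac)
  have V: "V \<in> carrier_mat l l" and VtV: "transpose_mat V * V = 1\<^sub>m l"
    using V_orth by (auto simp: orthogonal_matrix_of_size_def)
  define K where "K = kernel_mat k l Z"
  have K: "K \<in> carrier_mat l l" by (simp add: K_def kernel_mat_def)
  have Kt: "transpose_mat K = K" unfolding K_def kernel_mat_def
    by (rule eq_matI) (auto simp: sym)
  define P where "P = pinv K"
  note P = pinv_props[OF K, folded P_def]
  have Pt: "transpose_mat P = P" unfolding P_def transpose_pinv Kt ..
  define D where "D = mat_diag l \<kappa>"
  have D: "D \<in> carrier_mat l l" by (simp add: D_def)
  have Ht: "transpose_mat H \<in> carrier_mat l l" and Vt: "transpose_mat V \<in> carrier_mat l l"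
    using H V by auto
  note mc = mult_carrier_mat[where nr = l and n = l and nc = l]
  note assoc = assoc_mult_mat[where n\<^sub>1 = l and n\<^sub>2 = l and n\<^sub>3 = l and n\<^sub>4 = l]
  note cs = H V K D P(1) Ht Vt
  \<comment> \<open>Column p of N is the weight vector w obtained from u = v_p, so coordinates d of
    u give w = N d.\<close>
  define N where "N = P * (transpose_mat H * V)"
  have N: "N \<in> carrier_mat l l" unfolding N_def by (intro mc cs)
  have dec: "H * (P * transpose_mat H) = V * (D * transpose_mat V)"
    using decomposition assoc[OF H P(1) Ht] assoc[OF V D Vt] by (simp add: K_def P_def D_def)
  have "H * N = H * (P * transpose_mat H) * V"
    unfolding N_def by (simp add: assoc mc cs)
  also have "\<dots> = V * (D * (transpose_mat V * V))"
    unfolding dec by (simp add: assoc mc cs)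
  finally have HN: "H * N = V * D" using VtV D by simp
  have Nt: "transpose_mat N = transpose_mat V * (H * P)"
    unfolding N_def
    using transpose_mult[OF P(1) mc[OF Ht V]] transpose_mult[OF Ht V] Pt
    by (simp add: assoc mc cs)
  \<comment> \<open>As P K P = P, the factor P K acts as the identity on N. Hence N^T K N collapses
    to V^T H N = D, which diagonalizes the Hilbert space norm.\<close>
  have "P * (K * N) = P * K * P * (transpose_mat H * V)"
    unfolding N_def by (simp add: assoc mc cs)
  then have PKN: "P * (K * N) = N" using P(3) by (simp add: N_def)
  have "transpose_mat N * (K * N) = transpose_mat V * (H * (P * (K * N)))"
    unfolding Nt by (simp add: assoc mc cs N)
  also have "\<dots> = transpose_mat V * V * D"
    unfolding PKN HN by (simp add: assoc mc cs)
  finally have NKN: "transpose_mat N * (K * N) = D" using VtV D by simp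
  \<comment> \<open>Up to the factor \<sigma>_j, this is the e_j coefficient of the function built
    from column p. Killing it for j < i imposes i conditions on i + 1 unknowns.\<close>
  define f where "f j p = (\<Sum>a<l. N $$ (a, p) * e j (Z a))" for j p
  obtain c where c: "\<exists>p<Suc i. c p \<noteq> 0" "\<And>j. j < i \<Longrightarrow> (\<Sum>p<Suc i. f j p * c p) = 0"
    using exists_nonzero_solution[OF lessI[of i], of f] by blast
  \<comment> \<open>The solution is padded with zeros to length l; \<open>sum_d\<close> cuts sums
    back to the indices 0 to i.\<close>
  define d where "d = Matrix.vec l (\<lambda>p. if p < Suc i then c p else 0)"
  have d: "d \<in> carrier_vec l" by (simp add: d_def)
  have sum_d: "(\<Sum>p = 0..<l. g p (d $ p)) = (\<Sum>p<Suc i. g p (c p))"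
    if "\<And>p. g p 0 = 0" for g :: "nat \<Rightarrow> real \<Rightarrow> real"
    using i that by (intro sum.mono_neutral_cong_right) (auto simp: d_def)
  define w where "w = N *\<^sub>v d"
  have w: "w \<in> carrier_vec l" using N d by (simp add: w_def)
  have w_index: "w $ a = (\<Sum>p<Suc i. N $$ (a, p) * c p)" if "a < l" for a
    using sum_d[of "\<lambda>p x. N $$ (a, p) * x"] that N d
    by (simp add: w_def scalar_prod_def del: sum.lessThan_Suc)
  have vanish: "(\<Sum>a<l. w $ a * e j (Z a)) = 0" if "j < i" for j
  proof -
    have "(\<Sum>a<l. w $ a * e j (Z a)) = (\<Sum>a<l. \<Sum>p<Suc i. N $$ (a, p) * e j (Z a) * c p)"
      by (intro sum.cong refl) (simp add: w_index sum_distrib_left mult_ac del: sum.lessThan_Suc)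
    also have "\<dots> = (\<Sum>p<Suc i. f j p * c p)"
      by (subst sum.swap) (simp add: f_def sum_distrib_right del: sum.lessThan_Suc)
    finally show ?thesis using c(2) that by simp
  qed
  have Dd: "D *\<^sub>v d \<in> carrier_vec l" using D d by simp
  \<comment> \<open>Because H N = V D and V preserves norms, the squared norm in L2 is |D
    d|^2.\<close>
  have "H *\<^sub>v w = V *\<^sub>v (D *\<^sub>v d)"
    unfolding w_def using assoc_mult_mat_vec[OF H N d] assoc_mult_mat_vec[OF V D d] HN by simp
  moreover have "scalar_prod (V *\<^sub>v (D *\<^sub>v d)) (V *\<^sub>v (D *\<^sub>v d)) = scalar_prod (D *\<^sub>v d) (D *\<^sub>v d)"
    using scalar_prod_mult_mat_vec[OF V _ Dd, of "V *\<^sub>v (D *\<^sub>v d)"]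
      assoc_mult_mat_vec[OF Vt V Dd] VtV V Dd by simp
  ultimately have "scalar_prod (H *\<^sub>v w) (H *\<^sub>v w) = scalar_prod (D *\<^sub>v d) (D *\<^sub>v d)" by simp
  also have "\<dots> = (\<Sum>p = 0..<l. (\<kappa> p * d $ p)\<^sup>2)"
    using Dd d D by (simp add: scalar_prod_def[of _ "D *\<^sub>v d"] index_mat_diag_mult_vec[OF d, of _ \<kappa>, folded D_def]
        power2_eq_square del: index_mult_mat_vec)
  also have "\<dots> = (\<Sum>p<Suc i. (\<kappa> p * c p)\<^sup>2)" by (rule sum_d) simp
  finally have L2: "scalar_prod (H *\<^sub>v w) (H *\<^sub>v w) = (\<Sum>p<Suc i. (\<kappa> p * c p)\<^sup>2)" .
  have KN: "K * N \<in> carrier_mat l l" by (intro mc cs N)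
  have KNd: "(K * N) *\<^sub>v d \<in> carrier_vec l" using KN d by simp
  have Nt': "transpose_mat N \<in> carrier_mat l l" using N by simp
  have "scalar_prod w (K *\<^sub>v w) = scalar_prod (N *\<^sub>v d) ((K * N) *\<^sub>v d)"
    unfolding w_def using assoc_mult_mat_vec[OF K N d] by simp
  also have "\<dots> = scalar_prod d (transpose_mat N *\<^sub>v ((K * N) *\<^sub>v d))"
    using scalar_prod_mult_mat_vec[OF Nt' d KNd] by simp
  also have "\<dots> = scalar_prod d (D *\<^sub>v d)"
    using assoc_mult_mat_vec[OF Nt' KN d] NKN by simp
  also have "\<dots> = (\<Sum>p = 0..<l. \<kappa> p * (d $ p)\<^sup>2)"
    using Dd d D by (simp add: scalar_prod_def[of _ "D *\<^sub>v d"] index_mat_diag_mult_vec[OF d, of _ \<kappa>, folded D_def]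
        power2_eq_square mult_ac del: index_mult_mat_vec)
  also have "\<dots> = (\<Sum>p<Suc i. \<kappa> p * (c p)\<^sup>2)" by (rule sum_d) simp
  finally have rkhs: "scalar_prod w (K *\<^sub>v w) = (\<Sum>p<Suc i. \<kappa> p * (c p)\<^sup>2)" .
  have le: "(\<Sum>p<Suc i. (\<kappa> p * c p)\<^sup>2) \<le> \<sigma> i * (\<Sum>p<Suc i. \<kappa> p * (c p)\<^sup>2)"
    using kernel_combination_integral_le[OF on \<sigma> mercer vanish]
    unfolding integral_square_kernel_combination[OF sq sym H H_factor w] L2
      scalar_prod_kernel_mat[OF w, symmetric] K_def[symmetric] rkhs .
  \<comment> \<open>All indices present satisfy p <= i, so \<open>\<kappa> p\<close> is at least
    \<open>\<kappa> i\<close>.\<close>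
  have "\<kappa> i * (\<Sum>p<Suc i. \<kappa> p * (c p)\<^sup>2) \<le> (\<Sum>p<Suc i. (\<kappa> p * c p)\<^sup>2)"
    unfolding sum_distrib_left
  proof (rule sum_mono)
    fix p assume "p \<in> {..<Suc i}"
    then have "\<kappa> i \<le> \<kappa> p" using \<kappa>_decreasing i by simp
    then have "\<kappa> i * (\<kappa> p * (c p)\<^sup>2) \<le> \<kappa> p * (\<kappa> p * (c p)\<^sup>2)"
      using False by (intro mult_right_mono) auto
    then show "\<kappa> i * (\<kappa> p * (c p)\<^sup>2) \<le> (\<kappa> p * c p)\<^sup>2"
      by (simp add: power2_eq_square mult_ac)
  qed
  with le have "\<kappa> i * (\<Sum>p<Suc i. \<kappa> p * (c p)\<^sup>2) \<le> \<sigma> i * (\<Sum>p<Suc i. \<kappa> p * (c p)\<^sup>2)"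
    by linarith
  moreover have "0 < (\<Sum>p<Suc i. \<kappa> p * (c p)\<^sup>2)"
  proof -
    have pos: "0 < \<kappa> p" if "p < Suc i" for p
      using \<kappa>_decreasing[of p i] that i False by simp
    obtain p where p: "p < Suc i" "c p \<noteq> 0" using c(1) by blast
    show ?thesis
      by (rule sum_pos2[of _ p]) (use p pos in \<open>auto intro!: mult_nonneg_nonneg less_imp_le[OF pos]\<close>)
  qed
  ultimately show ?thesis using mult_right_le_imp_le by blast
qed

section \<open>Norms of the approximate eigenfunctions and the trace estimate\<close>

lemma nystrom_fun_eq:
  "nystrom_fun k l Z H V i x = (\<Sum>a<l. (pinv H *\<^sub>v col V i) $ a * k (Z a) x)"
  by (simp add: nystrom_fun_def scalar_prod_def kernel_vec_def lessThan_atLeast0)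

text \<open>The bound is an inequality because v_i may have a component orthogonal to the range of
  H, which the projection \<open>H * pinv H\<close> removes.\<close>

lemma integral_square_nystrom_fun_le_1:
  assumes sq: "\<And>z. square_integrable M (k z)" and sym: "\<And>x y. k x y = k y x"
    and H: "H \<in> carrier_mat m l"
    and H_factor: "transpose_mat H * H = kernel_mat (h_kernel M k) l Z"
    and V: "orthogonal_matrix_of_size m V" and i: "i < m"
  shows "integrable M (\<lambda>x. (nystrom_fun k l Z H V i x)\<^sup>2)"
    and "(\<integral>x. (nystrom_fun k l Z H V i x)\<^sup>2 \<partial>M) \<le> 1"
proof -
  show "integrable M (\<lambda>x. (nystrom_fun k l Z H V i x)\<^sup>2)"
    unfolding nystrom_fun_eq by (rule integrable_sum_mult_self(1)) (rule sq)
  note P = pinv_props[OF H]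
  have v: "col V i \<in> carrier_vec m" and Vc: "V \<in> carrier_mat m m"
    using V i by (auto simp: orthogonal_matrix_of_size_def)
  have w: "pinv H *\<^sub>v col V i \<in> carrier_vec l" using P v by simp
  have HP: "H * pinv H \<in> carrier_mat m m" using H P by simp
  have idem: "H * pinv H * (H * pinv H) = H * pinv H"
    using assoc_mult_mat[OF HP H P(1)] P(2) by simp
  have "(\<integral>x. (nystrom_fun k l Z H V i x)\<^sup>2 \<partial>M)
      = scalar_prod (H * pinv H *\<^sub>v col V i) (H * pinv H *\<^sub>v col V i)"
    unfolding nystrom_fun_eq integral_square_kernel_combination[OF sq sym H H_factor w]
    using assoc_mult_mat_vec[OF H P(1) v] by simp
  also have "\<dots> \<le> scalar_prod (col V i) (col V i)"
    by (rule scalar_prod_projection_le[OF HP P(4) idem v])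
  also have "\<dots> = (transpose_mat V * V) $$ (i, i)" using Vc i by simp
  also have "\<dots> = 1" using V i by (simp add: orthogonal_matrix_of_size_def)
  finally show "(\<integral>x. (nystrom_fun k l Z H V i x)\<^sup>2 \<partial>M) \<le> 1" .
qed

theorem theorem2:
  fixes M :: "'a::t2_space measure"
    and k :: "'a \<Rightarrow> 'a \<Rightarrow> real"
    and S :: "('a \<Rightarrow> real) set"
    and ip :: "('a \<Rightarrow> real) \<Rightarrow> ('a \<Rightarrow> real) \<Rightarrow> real"
    and \<sigma> :: "nat \<Rightarrow> real"
    and e :: "nat \<Rightarrow> 'a \<Rightarrow> real"
    and l s :: nat
    and Z :: "nat \<Rightarrow> 'a"
    and H V :: "real mat"
    and \<kappa> :: "nat \<Rightarrow> real"
  assumes prob: "prob_space M" and borel: "sets M = sets borel"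
    and pd: "positive_definite_kernel k"
    and diag_integrable: "integrable M (\<lambda>x. k x x)"
    and rkhs: "is_rkhs k S ip"
    and \<sigma>_decreasing: "\<And>i j. i \<le> j \<Longrightarrow> \<sigma> j \<le> \<sigma> i"
    and \<sigma>_nonneg: "\<And>i. 0 \<le> \<sigma> i"
    and e_orthonormal: "orthonormal_L2 M e"
    and eigenpairs: "\<And>i. AE x in M. integral_operator M k (e i) x = \<sigma> i * e i x"
    and mercer: "\<And>x y. (\<lambda>i. \<sigma> i * e i x * e i y) sums k x y"
    and rkhs_basis: "orthonormal_basis_on S ip {i. \<sigma> i > 0} (\<lambda>i x. sqrt (\<sigma> i) * e i x)"
    and H_dim: "H \<in> carrier_mat l l"
    and H_factor: "transpose_mat H * H = kernel_mat (h_kernel M k) l Z"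
    and V_orthogonal: "orthogonal_matrix_of_size l V"
    and \<kappa>_decreasing: "\<And>i j. i \<le> j \<Longrightarrow> j < l \<Longrightarrow> \<kappa> j \<le> \<kappa> i"
    and \<kappa>_nonneg: "\<And>i. i < l \<Longrightarrow> 0 \<le> \<kappa> i"
    and decomposition:
      "H * pinv (kernel_mat k l Z) * transpose_mat H = V * mat_diag l \<kappa> * transpose_mat V"
    and s_le: "s \<le> l"
  shows "(\<integral>x. nystrom_kernel k l Z H V \<kappa> x x - nystrom_kernel_trunc k l Z H V \<kappa> s x x \<partial>M)
           \<le> (\<Sum>i\<in>{s..<l}. \<sigma> i)"
proof -
  have sq: "square_integrable M (k z)" for z
    by (rule kernel_section_square_integrable[OF e_orthonormal \<sigma>_decreasing \<sigma>_nonneg mercer])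
  have sym: "k x y = k y x" for x y
    using mercer[of x y] mercer[of y x] by (simp add: sums_iff mult_ac)
  define g where "g i = nystrom_fun k l Z H V i" for i
  note g = integral_square_nystrom_fun_le_1[OF sq sym H_dim H_factor V_orthogonal, folded g_def]
  have "nystrom_kernel k l Z H V \<kappa> x x - nystrom_kernel_trunc k l Z H V \<kappa> s x x
      = (\<Sum>i\<in>{s..<l}. \<kappa> i * (g i x)\<^sup>2)" for x
  proof -
    \<comment> \<open>On the diagonal the two kernels differ by the terms with index from s to l -
      1.\<close>
    have "{..<l} = {..<s} \<union> {s..<l}" using s_le by auto
    then show ?thesis
      by (simp add: nystrom_kernel_def nystrom_kernel_trunc_def sum.union_disjoint g_def
          ivl_disj_int power2_eq_square mult.assoc)
  qed
  then have "(\<integral>x. nystrom_kernel k l Z H V \<kappa> x x - nystrom_kernel_trunc k l Z H V \<kappa> s x x \<partial>M)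
      = (\<Sum>i\<in>{s..<l}. \<kappa> i * (\<integral>x. (g i x)\<^sup>2 \<partial>M))"
    using g(1) by (simp add: Bochner_Integration.integral_sum)
  also have "\<dots> \<le> (\<Sum>i\<in>{s..<l}. \<sigma> i)"
  proof (rule sum_mono)
    fix i assume "i \<in> {s..<l}"
    then have i: "i < l" by simp
    have "\<kappa> i * (\<integral>x. (g i x)\<^sup>2 \<partial>M) \<le> \<kappa> i * 1"
      using g(2)[OF i] \<kappa>_nonneg[OF i] by (intro mult_left_mono) auto
    also have "\<kappa> i * 1 \<le> \<sigma> i"
      using nystrom_eigenvalue_le[OF e_orthonormal \<sigma>_decreasing \<sigma>_nonneg mercer H_dim H_factor
          V_orthogonal \<kappa>_decreasing decomposition i] by simp
    finally show "\<kappa> i * (\<integral>x. (g i x)\<^sup>2 \<partial>M) \<le> \<sigma> i" .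
  qed
  finally show ?thesis .
qed

end
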